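(* Let $\Gamma=(V,H)$ be a connected oriented hypergraph on $N$ vertices in which every vertex has positive degree, and let $\lambda_N$ be the largest eigenvalue of its normalized Laplacian. Then $$\lambda_N\leq \max_{h\in H}|h|,$$ with equality if and only if $\Gamma$ is bipartite and $|h|$ is the same for all $h\in H$. Moreover, $$\lambda_N\geq \max_{\hat{\Gamma}\subset\Gamma\ \text{bipartite}}\eta(\hat{\Gamma}),$$ where the maximum runs over all bipartite sub-hypergraphs $\hat\Gamma$ of $\Gamma$.
   Context: An oriented hypergraph is a pair $\Gamma=(V,H)$ with $V$ a finite vertex set and $H$ a finite set of hyperedges, each $h\in H$ being a pair $h=(V_h,W_h)$ of nonempty disjoint subsets of $V$ (inputs $V_h$, outputs $W_h$). A vertex $v$ belongs to $h$ ($v\in h$) if $v\in V_h\cup W_h$. The degree $\deg v$ is the number of hyperedges containing $v$; the cardinality of $h$ is $|h|:=|V_h|+|W_h|$. $\Gamma$ is connected if for all $v,w\in V$ there are vertices $v=v_1,\dots,v_m=w$ and hyperedges $h_1,\dots,h_{m-1}$ with $v_i,v_{i+1}\in h_i$. The normalized Laplacian acts on $f:V\to\mathbb{R}$ by $$Lf(v)=\frac{1}{\deg v}\Biggl[\sum_{h:\ v\in V_h}\Bigl(\sum_{v'\in V_h}f(v')-\sum_{w'\in W_h}f(w')\Bigr)-\sum_{h:\ v\in W_h}\Bigl(\sum_{v'\in V_h}f(v')-\sum_{w'\in W_h}f(w')\Bigr)\Biggr];$$ it has $N$ real nonnegative eigenvalues $\lambda_1\le\dots\le\lambda_N$, and (known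 fact) $\lambda_N=\max_{f\neq 0}\frac{\sum_{h\in H}\left(\sum_{v\in V_h}f(v)-\sum_{w\in W_h}f(w)\right)^2}{\sum_{v\in V}\deg(v) f(v)^2}$. $\Gamma$ is bipartite if $V=V_1\sqcup V_2$ such that every hyperedge has all its inputs in $V_1$ and all its outputs in $V_2$, or vice versa. A sub-hypergraph $\hat\Gamma=(\hat V,\hat H)$ of $\Gamma$ is determined by a vertex subset $\hat V\subseteq V$ and a nonempty subset $H'\subseteq H$ of hyperedges; its hyperedges are the restrictions $(V_h\cap\hat V,\,W_h\cap \hat V)$ for $h\in H'$, so $|\hat H|:=|H'|$, and $\deg_{\hat\Gamma}(v)$ for $v\in\hat V$ is the number of $h\in H'$ with $v\in h$. $\hat\Gamma$ is bipartite if $\hat V=V_1\sqcup V_2$ such that for every $h\in H'$, either $V_h\cap\hat V\subseteq V_1$ and $W_h\cap\hat V\subseteq V_2$, or vice versa. Finally $$\eta(\hat\Gamma):=\frac{\sum_{v\in\hat V}\frac{\deg_{\hat\Gamma}(v)^2}{\deg v}}{|\hat H|}.$$ *)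

theory Defs
  imports Complex_Main
begin

text \<open>A hyperedge is the pair of its input set and its output set.\<close>

type_synonym 'v hyperedge = "'v set \<times> 'v set"

abbreviation inputs :: "'v hyperedge \<Rightarrow> 'v set" where
  "inputs h \<equiv> fst h"

abbreviation outputs :: "'v hyperedge \<Rightarrow> 'v set" where
  "outputs h \<equiv> snd h"

definition members :: "'v hyperedge \<Rightarrow> 'v set" where
  "members h = inputs h \<union> outputs h"

definition hyperedge_card :: "'v hyperedge \<Rightarrow> nat" where
  "hyperedge_card h = card (inputs h) + card (outputs h)"

definition oriented_hypergraph :: "'v set \<Rightarrow> 'v hyperedge set \<Rightarrow> bool" where
  "oriented_hypergraph V H \<longleftrightarrow>
     finite V \<and> finite H \<and>
     (\<forall>h\<in>H. inputs h \<noteq> {} \<and> outputs h \<noteq> {} \<and> inputs h \<inter> outputs h = {} \<and>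
            inputs h \<subseteq> V \<and> outputs h \<subseteq> V)"

definition vertex_degree :: "'v hyperedge set \<Rightarrow> 'v \<Rightarrow> nat" where
  "vertex_degree H v = card {h \<in> H. v \<in> members h}"

definition connected_hypergraph :: "'v set \<Rightarrow> 'v hyperedge set \<Rightarrow> bool" where
  "connected_hypergraph V H \<longleftrightarrow>
     (\<forall>v\<in>V. \<forall>w\<in>V. \<exists>vs hs.
        length vs = Suc (length hs) \<and> hd vs = v \<and> last vs = w \<and>
        set vs \<subseteq> V \<and> set hs \<subseteq> H \<and>
        (\<forall>i<length hs. vs ! i \<in> members (hs ! i) \<and> vs ! Suc i \<in> members (hs ! i)))"

definition signed_sum :: "('v \<Rightarrow> real) \<Rightarrow> 'v hyperedge \<Rightarrow> real" where
  "signed_sum f h = (\<Sum>v\<in>inputs h. f v) - (\<Sum>w\<in>outputs h. f w)"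

definition normalized_laplacian ::
  "'v hyperedge set \<Rightarrow> ('v \<Rightarrow> real) \<Rightarrow> 'v \<Rightarrow> real" where
  "normalized_laplacian H f v =
     ((\<Sum>h\<in>{h \<in> H. v \<in> inputs h}. signed_sum f h) -
      (\<Sum>h\<in>{h \<in> H. v \<in> outputs h}. signed_sum f h)) / real (vertex_degree H v)"

text \<open>Functions on \<open>V\<close> are represented by total functions of which only the values on \<open>V\<close>
  matter; so an eigenfunction must be nonzero somewhere on \<open>V\<close>, and the eigenvalue equation is
  required on \<open>V\<close> only.\<close>

definition laplacian_eigenvalue :: "'v set \<Rightarrow> 'v hyperedge set \<Rightarrow> real \<Rightarrow> bool" where
  "laplacian_eigenvalue V H \<mu> \<longleftrightarrow>
     (\<exists>f. (\<exists>v\<in>V. f v \<noteq> 0) \<and> (\<forall>v\<in>V. normalized_laplacian H f v = \<mu> * f v))"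

text \<open>For nonempty \<open>V\<close> and positive degrees the set below is finite and nonempty, because the
  Laplacian is self-adjoint with respect to the inner product weighted by the degrees.\<close>

definition largest_eigenvalue :: "'v set \<Rightarrow> 'v hyperedge set \<Rightarrow> real" where
  "largest_eigenvalue V H = Max {\<mu>. laplacian_eigenvalue V H \<mu>}"

definition bipartite_hypergraph :: "'v set \<Rightarrow> 'v hyperedge set \<Rightarrow> bool" where
  "bipartite_hypergraph V H \<longleftrightarrow>
     (\<exists>V1 V2. V1 \<union> V2 = V \<and> V1 \<inter> V2 = {} \<and>
        (\<forall>h\<in>H. (inputs h \<subseteq> V1 \<and> outputs h \<subseteq> V2) \<or> (inputs h \<subseteq> V2 \<and> outputs h \<subseteq> V1)))"

definition restrict_hyperedge :: "'v set \<Rightarrow> 'v hyperedge \<Rightarrow> 'v hyperedge" where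
  "restrict_hyperedge U h = (inputs h \<inter> U, outputs h \<inter> U)"

text \<open>A sub-hypergraph is encoded by the pair \<open>(U, H')\<close> of its vertex set and the set of
  \<^emph>\<open>unrestricted\<close> hyperedges of \<open>H\<close> that it uses. Distinct members of \<open>H'\<close> may have the same
  restriction to \<open>U\<close> and still count as distinct hyperedges, so degrees and the number of
  hyperedges are computed from \<open>H'\<close> itself. Restricted hyperedges may have no inputs or no
  outputs.\<close>

definition sub_hypergraphs ::
  "'v set \<Rightarrow> 'v hyperedge set \<Rightarrow> ('v set \<times> 'v hyperedge set) set" where
  "sub_hypergraphs V H = {(U, H'). U \<subseteq> V \<and> H' \<subseteq> H \<and> H' \<noteq> {}}"

definition bipartite_sub_hypergraphs ::
  "'v set \<Rightarrow> 'v hyperedge set \<Rightarrow> ('v set \<times> 'v hyperedge set) set" where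
  "bipartite_sub_hypergraphs V H =
     {(U, H') \<in> sub_hypergraphs V H. bipartite_hypergraph U (restrict_hyperedge U ` H')}"

definition eta_ratio :: "'v hyperedge set \<Rightarrow> 'v set \<times> 'v hyperedge set \<Rightarrow> real" where
  "eta_ratio H = (\<lambda>(U, H').
     (\<Sum>v\<in>U. (real (vertex_degree H' v))\<^sup>2 / real (vertex_degree H v)) / real (card H'))"

end

theory Submission
  imports Defs "HOL-Analysis.Analysis"
begin

text \<open>The Laplacian is self-adjoint for the degree-weighted inner product, and its quadratic form is
  the sum of the squared signed sums. Maximizing that form over the compact unit sphere yields an
  eigenfunction, so the largest eigenvalue is the maximal Rayleigh quotient. The upper bound is
  Cauchy--Schwarz on each hyperedge; equality forces every eigenfunction of the largest eigenvalue
  to have constant absolute value on hyperedges, hence on \<open>V\<close> by connectedness, and its signs give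
  the bipartition. For the lower bound, a bipartition of a sub-hypergraph provides signs \<open>\<gamma> h = \<plusminus>1\<close> on
  its hyperedges for which no cancellation occurs at its vertices, and the adjoint of the incidence
  map applied to \<open>\<gamma>\<close> is the test function.\<close>

subsection \<open>Sums of squares\<close>

text \<open>Equality case of Cauchy-Schwarz against the constant function: the hypothesis makes the
  sum of squared deviations from the mean \<open>m\<close> vanish.\<close>

lemma sum_squared_eq_card_times_sum_of_squares:
  fixes g :: "'a \<Rightarrow> real"
  assumes "finite A" and eq: "(\<Sum>v\<in>A. g v)\<^sup>2 = real (card A) * (\<Sum>v\<in>A. (g v)\<^sup>2)"
    and "v \<in> A" and "w \<in> A"
  shows "g v = g w"
proof -
  define m where "m = (\<Sum>v\<in>A. g v) / real (card A)"
  have card: "real (card A) > 0"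
    using assms card_gt_0_iff by (metis empty_iff of_nat_0_less_iff)
  have "(\<Sum>v\<in>A. (g v - m)\<^sup>2) = (\<Sum>v\<in>A. (g v)\<^sup>2) - 2 * m * (\<Sum>v\<in>A. g v) + real (card A) * m\<^sup>2"
    by (simp add: power2_diff sum.distrib sum_subtractf mult_ac flip: sum_distrib_left sum_distrib_right)
  also have "\<dots> = (\<Sum>v\<in>A. (g v)\<^sup>2) - (\<Sum>v\<in>A. g v)\<^sup>2 / real (card A)"
    using card by (simp add: m_def power2_eq_square field_simps)
  also have "\<dots> = 0"
    using card eq by simp
  finally have "\<forall>v\<in>A. (g v - m)\<^sup>2 = 0"
    using \<open>finite A\<close> by (simp add: sum_nonneg_eq_0_iff)
  with assms show ?thesis by simp
qed

text \<open>First-order condition at the minimum \<open>t = 0\<close>; it later turns maximality of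
  the Rayleigh quotient into the eigenvalue equation.\<close>

lemma linear_term_zero_of_quadratic_nonneg:
  fixes a b :: real
  assumes "\<And>t. 0 \<le> 2 * t * b + t\<^sup>2 * a"
  shows "b = 0"
proof (rule ccontr)
  assume "b \<noteq> 0"
  \<comment> \<open>Minimizer of the quadratic after \<open>a\<close> is raised to
    \<open>\<bar>a\<bar> + 1\<close>, which is positive whatever the sign of
    \<open>a\<close>.\<close>
  define t where "t = - b / (\<bar>a\<bar> + 1)"
  have pos: "\<bar>a\<bar> + 1 > 0" by simp
  have "2 * t * b + t\<^sup>2 * a \<le> 2 * t * b + t\<^sup>2 * (\<bar>a\<bar> + 1)"
    by (simp add: mult_left_mono)
  also have "\<dots> = - (b\<^sup>2 / (\<bar>a\<bar> + 1))"
    using pos by (simp add: t_def power2_eq_square divide_simps)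
  also have "\<dots> < 0"
    using pos \<open>b \<noteq> 0\<close> by simp
  finally show False using assms[of t] by simp
qed

text \<open>The type \<open>'v\<close> may be infinite, so functions carry the product topology and
  are pinned to 0 off \<open>V\<close>. The bound \<open>d v \<ge> 1\<close> confines the values on
  \<open>V\<close> to [-1, 1], which leaves a closed subset of a product that is compact by
  Tychonoff.\<close>

lemma compact_unit_ellipsoid:
  fixes d :: "'v \<Rightarrow> real"
  assumes "finite V" and d: "\<forall>v\<in>V. d v \<ge> 1"
  shows "compact {f. (\<forall>v. v \<notin> V \<longrightarrow> f v = 0) \<and> (\<Sum>v\<in>V. d v * (f v)\<^sup>2) = 1}"
    (is "compact ?S")
proof -
  define K where "K = (\<Pi>\<^sub>E v\<in>UNIV. if v \<in> V then {-1..1::real} else {0})"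
  have "compactin (product_topology (\<lambda>v::'v. euclidean) UNIV) K"
    unfolding K_def by (auto simp: compactin_PiE)
  then have K: "compact K"
    by (simp add: euclidean_product_topology)
  have "closed {f. (\<Sum>v\<in>V. d v * (f v)\<^sup>2) = 1}"
    by (intro closed_Collect_eq continuous_intros continuous_on_product_coordinates)
  moreover have "?S = K \<inter> {f. (\<Sum>v\<in>V. d v * (f v)\<^sup>2) = 1}"
  proof -
    have "\<bar>f v\<bar> \<le> 1" if "(\<Sum>v\<in>V. d v * (f v)\<^sup>2) = 1" "v \<in> V" for f v
    proof -
      have "1 * (f v)\<^sup>2 \<le> d v * (f v)\<^sup>2"
        using d that by (intro mult_right_mono) auto
      also have "\<dots> \<le> (\<Sum>v\<in>V. d v * (f v)\<^sup>2)"
        using d that \<open>finite V\<close>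
        by (intro member_le_sum mult_nonneg_nonneg) (auto intro: order_trans[OF zero_le_one])
      finally show ?thesis using that by (simp add: abs_square_le_1)
    qed
    then show ?thesis
      by (force simp: K_def PiE_iff abs_le_iff split: if_split_asm)
  qed
  ultimately show ?thesis
    using K by (simp add: compact_Int_closed)
qed

subsection \<open>The Laplacian as a self-adjoint operator\<close>

text \<open>Entry of the signed incidence matrix B, with rows indexed by vertices. Then
  \<open>signed_sum\<close> is the transpose of B, and the Laplacian is B times its transpose,
  divided by the degrees.\<close>

definition incidence :: "'v hyperedge \<Rightarrow> 'v \<Rightarrow> real" where
  "incidence h v = of_bool (v \<in> inputs h) - of_bool (v \<in> outputs h)"

definition weighted_inner ::
  "'v set \<Rightarrow> 'v hyperedge set \<Rightarrow> ('v \<Rightarrow> real) \<Rightarrow> ('v \<Rightarrow> real) \<Rightarrow> real" where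
  "weighted_inner V H f g = (\<Sum>v\<in>V. real (vertex_degree H v) * (f v * g v))"

text \<open>Numerator of the Rayleigh quotient, kept bilinear so that self-adjointness and the weak
  eigenvalue equation can be expressed.\<close>

definition energy :: "'v hyperedge set \<Rightarrow> ('v \<Rightarrow> real) \<Rightarrow> ('v \<Rightarrow> real) \<Rightarrow> real" where
  "energy H f g = (\<Sum>h\<in>H. signed_sum f h * signed_sum g h)"

locale positive_degree_hypergraph =
  fixes V :: "'v set" and H :: "'v hyperedge set"
  assumes hypergraph: "oriented_hypergraph V H"
    and vertices_nonempty: "V \<noteq> {}"
    and degree_pos: "\<And>v. v \<in> V \<Longrightarrow> vertex_degree H v > 0"
begin

abbreviation inner :: "('v \<Rightarrow> real) \<Rightarrow> ('v \<Rightarrow> real) \<Rightarrow> real" where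
  "inner \<equiv> weighted_inner V H"

lemma finite_V [simp]: "finite V" and finite_H [simp]: "finite H"
  using hypergraph by (auto simp: oriented_hypergraph_def)

lemma hyperedge:
  assumes "h \<in> H"
  shows "inputs h \<noteq> {}" "inputs h \<inter> outputs h = {}" "members h \<subseteq> V"
    "finite (inputs h)" "finite (outputs h)" "finite (members h)"
  using assms hypergraph finite_subset[OF _ finite_V]
  by (auto simp: oriented_hypergraph_def members_def)

text \<open>A vertex of positive degree lies in some hyperedge. Hence maxima over \<open>H\<close>
  are attained.\<close>

lemma edges_nonempty: "H \<noteq> {}"
  using vertices_nonempty degree_pos by (fastforce simp: vertex_degree_def)

lemma card_members: "h \<in> H \<Longrightarrow> card (members h) = hyperedge_card h"
  using hyperedge[of h] by (simp add: members_def hyperedge_card_def card_Un_disjoint)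

text \<open>Summing over the members only, rather than over \<open>V\<close>, gives Cauchy-Schwarz
  its sharp constant, the cardinality of \<open>h\<close>.\<close>

lemma signed_sum_eq_members:
  assumes "h \<in> H"
  shows "signed_sum f h = (\<Sum>v\<in>members h. incidence h v * f v)"
proof -
  have "(\<Sum>v\<in>members h. incidence h v * f v)
      = (\<Sum>v\<in>inputs h. incidence h v * f v) + (\<Sum>v\<in>outputs h. incidence h v * f v)"
    using hyperedge[OF assms] by (simp add: members_def sum.union_disjoint)
  also have "(\<Sum>v\<in>inputs h. incidence h v * f v) = (\<Sum>v\<in>inputs h. f v)"
    using hyperedge[OF assms] by (intro sum.cong) (auto simp: incidence_def)
  also have "(\<Sum>v\<in>outputs h. incidence h v * f v) = (\<Sum>v\<in>outputs h. - f v)"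
    using hyperedge[OF assms] by (intro sum.cong) (auto simp: incidence_def)
  finally show ?thesis by (simp add: signed_sum_def sum_negf)
qed

lemma signed_sum_eq:
  assumes "h \<in> H"
  shows "signed_sum f h = (\<Sum>v\<in>V. incidence h v * f v)"
  unfolding signed_sum_eq_members[OF assms]
  using hyperedge[OF assms]
  by (intro sum.mono_neutral_left) (auto simp: incidence_def members_def)

lemma incidence_inputs: "h \<in> H \<Longrightarrow> v \<in> inputs h \<Longrightarrow> incidence h v = 1"
  and incidence_outputs: "h \<in> H \<Longrightarrow> v \<in> outputs h \<Longrightarrow> incidence h v = -1"
  using hyperedge(2)[of h] by (auto simp: incidence_def)

lemma incidence_square: "h \<in> H \<Longrightarrow> v \<in> members h \<Longrightarrow> (incidence h v)\<^sup>2 = 1"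
  using hyperedge[of h] by (auto simp: incidence_def members_def)

lemma laplacian_eq:
  assumes "v \<in> V"
  shows "real (vertex_degree H v) * normalized_laplacian H f v
    = (\<Sum>h\<in>H. incidence h v * signed_sum f h)"
proof -
  have "(\<Sum>h\<in>H. incidence h v * signed_sum f h)
      = (\<Sum>h\<in>H. if v \<in> inputs h then signed_sum f h else 0)
        - (\<Sum>h\<in>H. if v \<in> outputs h then signed_sum f h else 0)"
    unfolding sum_subtractf[symmetric]
    by (intro sum.cong) (auto simp: incidence_def)
  then show ?thesis
    using degree_pos[OF assms]
    by (simp add: normalized_laplacian_def sum.inter_filter)
qed

text \<open>Applied to \<open>\<gamma> h = signed_sum f h\<close> this is Green's formula.\<close>

lemma sum_incidence_swap:
  "(\<Sum>v\<in>V. (\<Sum>h\<in>H. incidence h v * \<gamma> h) * g v) = (\<Sum>h\<in>H. \<gamma> h * signed_sum g h)"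
proof -
  have "(\<Sum>v\<in>V. (\<Sum>h\<in>H. incidence h v * \<gamma> h) * g v)
      = (\<Sum>v\<in>V. \<Sum>h\<in>H. \<gamma> h * (incidence h v * g v))"
    by (simp add: sum_distrib_left sum_distrib_right mult_ac)
  also have "\<dots> = (\<Sum>h\<in>H. \<Sum>v\<in>V. \<gamma> h * (incidence h v * g v))"
    by (rule sum.swap)
  finally show ?thesis
    by (simp add: signed_sum_eq sum_distrib_left)
qed

text \<open>The weights of \<open>inner\<close> cancel the division by the degree, and Green's
  formula does the rest. Symmetry of the right-hand side is self-adjointness.\<close>

lemma inner_laplacian: "inner (normalized_laplacian H f) g = energy H f g"
proof -
  have "inner (normalized_laplacian H f) g
      = (\<Sum>v\<in>V. (\<Sum>h\<in>H. incidence h v * signed_sum f h) * g v)"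
    unfolding weighted_inner_def
    by (intro sum.cong) (simp_all add: laplacian_eq[symmetric])
  then show ?thesis by (simp add: sum_incidence_swap energy_def)
qed

lemma inner_commute: "inner f g = inner g f"
  and inner_scale_left: "inner (\<lambda>v. c * f v) k = c * inner f k"
  by (simp_all add: weighted_inner_def algebra_simps sum.distrib sum_distrib_left)

lemma signed_sum_add: "signed_sum (\<lambda>v. f v + g v) h = signed_sum f h + signed_sum g h"
  and signed_sum_scale: "signed_sum (\<lambda>v. c * f v) h = c * signed_sum f h"
  by (simp_all add: signed_sum_def sum.distrib sum_distrib_left algebra_simps)

lemma energy_commute: "energy H f g = energy H g f"
  and energy_scale_left: "energy H (\<lambda>v. c * f v) k = c * energy H f k"
  by (simp_all add: energy_def signed_sum_add signed_sum_scale algebra_simps sum.distrib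
      sum_distrib_left)

lemma inner_self_nonneg: "inner f f \<ge> 0"
  by (auto simp: weighted_inner_def intro!: sum_nonneg)

lemma inner_self_pos:
  assumes "v \<in> V" and "f v \<noteq> 0"
  shows "inner f f > 0"
  unfolding weighted_inner_def
  using assms degree_pos by (intro sum_pos2[of V v]) (auto simp: zero_less_mult_iff linorder_neq_iff)

lemma inner_delta:
  assumes "v \<in> V"
  shows "inner f (\<lambda>w. of_bool (w = v)) = real (vertex_degree H v) * f v"
  using assms by (simp add: weighted_inner_def sum.delta of_bool_def if_distrib cong: if_cong)

text \<open>Weak form of the eigenvalue equation. The converse tests with the indicator of a single
  vertex and cancels its positive degree.\<close>

lemma eigenfunction_iff:
  "(\<forall>v\<in>V. normalized_laplacian H f v = \<mu> * f v) \<longleftrightarrow> (\<forall>g. energy H f g = \<mu> * inner f g)"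
proof
  assume L: "\<forall>v\<in>V. normalized_laplacian H f v = \<mu> * f v"
  show "\<forall>g. energy H f g = \<mu> * inner f g"
  proof
    fix g
    have "inner (normalized_laplacian H f) g = inner (\<lambda>v. \<mu> * f v) g"
      using L by (simp add: weighted_inner_def)
    then show "energy H f g = \<mu> * inner f g"
      by (simp add: inner_laplacian inner_scale_left)
  qed
next
  assume weak: "\<forall>g. energy H f g = \<mu> * inner f g"
  show "\<forall>v\<in>V. normalized_laplacian H f v = \<mu> * f v"
  proof
    fix v assume v: "v \<in> V"
    have "inner (normalized_laplacian H f) (\<lambda>w. of_bool (w = v))
        = \<mu> * inner f (\<lambda>w. of_bool (w = v))"
      using weak by (simp add: inner_laplacian)
    then show "normalized_laplacian H f v = \<mu> * f v"
      using degree_pos[OF v] by (simp add: inner_delta[OF v])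
  qed
qed

text \<open>Positive degrees make \<open>inner\<close> definite on \<open>V\<close>, so an
  eigenfunction can be scaled to norm 1; its energy is then the eigenvalue itself.\<close>

lemma laplacian_eigenvalue_iff:
  "laplacian_eigenvalue V H \<mu>
    \<longleftrightarrow> (\<exists>f. inner f f = 1 \<and> (\<forall>g. energy H f g = \<mu> * inner f g))"
proof
  assume "laplacian_eigenvalue V H \<mu>"
  then obtain f v where v: "v \<in> V" "f v \<noteq> 0" and f: "\<forall>g. energy H f g = \<mu> * inner f g"
    by (auto simp: laplacian_eigenvalue_def eigenfunction_iff)
  define c where "c = 1 / sqrt (inner f f)"
  have "inner (\<lambda>v. c * f v) (\<lambda>v. c * f v) = c\<^sup>2 * inner f f"
    by (metis inner_commute inner_scale_left mult.assoc power2_eq_square)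
  also have "\<dots> = 1"
    using inner_self_pos[of v f] v by (simp add: c_def power_divide)
  finally show "\<exists>f. inner f f = 1 \<and> (\<forall>g. energy H f g = \<mu> * inner f g)"
    using f by (intro exI[of _ "\<lambda>v. c * f v"]) (simp add: energy_scale_left inner_scale_left)
next
  assume "\<exists>f. inner f f = 1 \<and> (\<forall>g. energy H f g = \<mu> * inner f g)"
  then obtain f where "inner f f = 1" and "\<forall>g. energy H f g = \<mu> * inner f g"
    by blast
  moreover from this have "\<exists>v\<in>V. f v \<noteq> 0"
    by (force simp: weighted_inner_def intro: ccontr)
  ultimately show "laplacian_eigenvalue V H \<mu>"
    by (auto simp: laplacian_eigenvalue_def eigenfunction_iff)
qed

subsection \<open>Finiteness of the spectrum and the Rayleigh quotient\<close>

text \<open>Bessel's inequality for the indicator of \<open>v\<close>, whose squared norm is the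
  degree \<open>d\<close>, divided by \<open>d\<close>.\<close>

lemma bessel_at_vertex:
  assumes "finite M" and ortho: "\<And>i j. i \<in> M \<Longrightarrow> j \<in> M \<Longrightarrow> inner (F i) (F j) = of_bool (i = j)"
    and v: "v \<in> V"
  shows "(\<Sum>i\<in>M. real (vertex_degree H v) * (F i v * F i v)) \<le> 1"
proof -
  define d where "d = real (vertex_degree H v)"
  have d: "d > 0" using degree_pos[OF v] by (simp add: d_def)
  define \<delta> :: "'v \<Rightarrow> real" where "\<delta> = (\<lambda>w. of_bool (w = v))"
  \<comment> \<open>Orthogonal projection of \<open>\<delta>\<close> onto the span of the
    \<open>F i\<close>: the coefficients \<open>d * F i v\<close> are the inner products of
    \<open>F i\<close> with \<open>\<delta>\<close>.\<close>
  define p where "p = (\<lambda>w. \<Sum>i\<in>M. d * F i v * F i w)"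
  have p_left: "inner p g = (\<Sum>i\<in>M. d * F i v * inner (F i) g)" for g
  proof -
    have "inner p g = (\<Sum>w\<in>V. \<Sum>i\<in>M. d * F i v * (real (vertex_degree H w) * (F i w * g w)))"
      by (simp add: weighted_inner_def p_def sum_distrib_left sum_distrib_right mult_ac)
    also have "\<dots> = (\<Sum>i\<in>M. \<Sum>w\<in>V. d * F i v * (real (vertex_degree H w) * (F i w * g w)))"
      by (rule sum.swap)
    finally show ?thesis by (simp add: weighted_inner_def sum_distrib_left)
  qed
  define S where "S = (\<Sum>i\<in>M. d * (F i v * F i v))"
  have p_F: "inner (F i) p = d * F i v" if "i \<in> M" for i
  proof -
    have "inner (F i) p = (\<Sum>j\<in>M. d * F j v * of_bool (j = i))"
      unfolding inner_commute[of "F i"] p_left using that by (intro sum.cong) (simp_all add: ortho)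
    then show ?thesis using that \<open>finite M\<close>
      by (simp add: of_bool_def if_distrib sum.delta cong: if_cong)
  qed
  have "inner p p = (\<Sum>i\<in>M. d * F i v * (d * F i v))"
    unfolding p_left by (intro sum.cong) (simp_all add: p_F)
  then have pp: "inner p p = d * S"
    by (simp add: S_def sum_distrib_left mult_ac)
  have p\<delta>: "inner p \<delta> = d * S"
    unfolding \<delta>_def inner_delta[OF v] p_def S_def d_def by (simp add: sum_distrib_left mult_ac)
  have "inner \<delta> \<delta> = d"
    unfolding \<delta>_def inner_delta[OF v] by (simp add: d_def)
  moreover have "inner (\<lambda>w. \<delta> w + (-1) * p w) (\<lambda>w. \<delta> w + (-1) * p w)
      = inner \<delta> \<delta> - 2 * inner p \<delta> + inner p p"
    by (simp add: weighted_inner_def algebra_simps sum.distrib sum_subtractf sum_distrib_left)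
  ultimately have "0 \<le> d - d * S"
    using inner_self_nonneg[of "\<lambda>w. \<delta> w + (-1) * p w"] pp p\<delta> by linarith
  then have "d * S \<le> d * 1" by linarith
  then show ?thesis using d by (simp add: S_def d_def)
qed

text \<open>A trace computation in place of a dimension argument: the squared norms of orthonormal
  eigenfunctions add up to \<open>card M\<close>, while Bessel lets each vertex contribute at most
  1.\<close>

lemma card_eigenvalues_le:
  assumes "finite M" and M: "M \<subseteq> {\<mu>. laplacian_eigenvalue V H \<mu>}"
  shows "card M \<le> card V"
proof -
  have "\<forall>\<mu>\<in>M. \<exists>f. inner f f = 1 \<and> (\<forall>g. energy H f g = \<mu> * inner f g)"
    using M laplacian_eigenvalue_iff by blast
  then obtain F where norm: "\<And>\<mu>. \<mu> \<in> M \<Longrightarrow> inner (F \<mu>) (F \<mu>) = 1"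
    and eig: "\<And>\<mu> g. \<mu> \<in> M \<Longrightarrow> energy H (F \<mu>) g = \<mu> * inner (F \<mu>) g"
    by metis
  have ortho: "inner (F i) (F j) = of_bool (i = j)" if "i \<in> M" "j \<in> M" for i j
  proof -
    \<comment> \<open>Both sides equal the energy of the pair, by its symmetry; so distinct
      eigenvalues force orthogonality.\<close>
    have "i * inner (F i) (F j) = j * inner (F i) (F j)"
      using eig[OF that(1), of "F j"] eig[OF that(2), of "F i"]
      by (simp add: inner_commute energy_commute)
    then show ?thesis using norm that by (cases "i = j") auto
  qed
  have "real (card M) = (\<Sum>i\<in>M. inner (F i) (F i))"
    by (simp add: norm)
  also have "\<dots> = (\<Sum>v\<in>V. \<Sum>i\<in>M. real (vertex_degree H v) * (F i v * F i v))"
    unfolding weighted_inner_def by (rule sum.swap)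
  also have "\<dots> \<le> (\<Sum>v\<in>V. 1)"
    by (intro sum_mono bessel_at_vertex[OF \<open>finite M\<close> ortho])
  finally show ?thesis by simp
qed

text \<open>Needed for the \<open>Max\<close> in \<open>largest_eigenvalue\<close> to be a genuine
  maximum.\<close>

lemma finite_eigenvalues: "finite {\<mu>. laplacian_eigenvalue V H \<mu>}"
proof (rule ccontr)
  assume "infinite {\<mu>. laplacian_eigenvalue V H \<mu>}"
  then obtain M where "M \<subseteq> {\<mu>. laplacian_eigenvalue V H \<mu>}" "finite M" "card M = Suc (card V)"
    using infinite_arbitrarily_large by metis
  then show False using card_eigenvalues_le by fastforce
qed

text \<open>The energy attains its maximum \<open>\<mu>\<close> on the compact unit sphere. Scaling
  extends the bound to all functions, and the variation \<open>f + t * g\<close> of a maximizer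
  \<open>f\<close> yields the weak eigenvalue equation.\<close>

lemma exists_maximal_eigenvalue:
  obtains \<mu> where "laplacian_eigenvalue V H \<mu>" and "\<And>f. energy H f f \<le> \<mu> * inner f f"
proof -
  define S where "S = {f. (\<forall>v. v \<notin> V \<longrightarrow> f v = 0) \<and> inner f f = 1}"
  have "S = {f. (\<forall>v. v \<notin> V \<longrightarrow> f v = 0) \<and> (\<Sum>v\<in>V. real (vertex_degree H v) * (f v)\<^sup>2) = 1}"
    by (simp add: S_def weighted_inner_def power2_eq_square)
  then have S_compact: "compact S"
    using degree_pos by (simp add: compact_unit_ellipsoid Suc_le_eq)
  \<comment> \<open>Besides scaling, the function is cut off outside \<open>V\<close> to land in
    \<open>S\<close>; neither \<open>inner\<close> nor the signed sums see those values.\<close>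
  have normalized: "\<exists>c. c \<noteq> 0 \<and> c\<^sup>2 * inner f f = 1 \<and> (\<lambda>v. if v \<in> V then c * f v else 0) \<in> S"
    if "inner f f > 0" for f
  proof -
    define c where "c = 1 / sqrt (inner f f)"
    have c: "c \<noteq> 0" "c\<^sup>2 * inner f f = 1"
      using that by (simp_all add: c_def power_divide)
    moreover have "inner (\<lambda>v. if v \<in> V then c * f v else 0) (\<lambda>v. if v \<in> V then c * f v else 0)
        = c\<^sup>2 * inner f f"
      by (simp add: weighted_inner_def sum_distrib_left power2_eq_square mult_ac)
    ultimately show ?thesis by (auto simp: S_def)
  qed
  obtain v where "v \<in> V" using vertices_nonempty by blast
  then have "S \<noteq> {}"
    using normalized[OF inner_self_pos[of v "\<lambda>_. 1"]] by auto
  moreover have "continuous_on S (\<lambda>f. energy H f f)"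
    unfolding energy_def signed_sum_def
    by (intro continuous_intros continuous_on_subset[OF continuous_on_product_coordinates]) auto
  ultimately have "\<exists>f\<in>S. \<forall>g\<in>S. energy H g g \<le> energy H f f"
    by (rule continuous_attains_sup[OF S_compact])
  then obtain f where f: "f \<in> S" and max: "\<And>g. g \<in> S \<Longrightarrow> energy H g g \<le> energy H f f"
    by blast
  define \<mu> where "\<mu> = energy H f f"
  have ff: "inner f f = 1" using f by (simp add: S_def)
  have le: "energy H g g \<le> \<mu> * inner g g" for g
  proof (cases "inner g g > 0")
    case True
    then obtain c where c: "c \<noteq> 0" "c\<^sup>2 * inner g g = 1"
      and cS: "(\<lambda>v. if v \<in> V then c * g v else 0) \<in> S" (is "?g \<in> S")
      using normalized by blast
    have "signed_sum ?g h = c * signed_sum g h" if "h \<in> H" for h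
      by (simp add: signed_sum_eq[OF that] sum_distrib_left mult_ac)
    then have "c\<^sup>2 * energy H g g = energy H ?g ?g"
      by (simp add: energy_def sum_distrib_left power2_eq_square mult_ac)
    also have "\<dots> \<le> \<mu> * (c\<^sup>2 * inner g g)"
      using max[OF cS] c by (simp add: \<mu>_def)
    finally have "c\<^sup>2 * energy H g g \<le> c\<^sup>2 * (\<mu> * inner g g)"
      by (simp add: mult_ac)
    then show ?thesis using c by simp
  next
    case False
    then have "\<forall>v\<in>V. g v = 0" using inner_self_pos by blast
    then show ?thesis by (simp add: energy_def signed_sum_eq weighted_inner_def)
  qed
  have "energy H f g = \<mu> * inner f g" for g
  proof -
    \<comment> \<open>The quadratic in \<open>t\<close> given by
      \<open>\<mu> * inner k k - energy H k k\<close> is nonnegative and has no constant term, so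
      its linear coefficient vanishes.\<close>
    have "\<mu> * inner f g - energy H f g = 0"
    proof (rule linear_term_zero_of_quadratic_nonneg)
      fix t :: real
      define k where "k = (\<lambda>v. f v + t * g v)"
      have "energy H k k = energy H f f + 2 * t * energy H f g + t\<^sup>2 * energy H g g"
        unfolding k_def energy_def signed_sum_add signed_sum_scale
        by (simp add: algebra_simps sum.distrib sum_distrib_left power2_eq_square)
      moreover have "inner k k = inner f f + 2 * t * inner f g + t\<^sup>2 * inner g g"
        unfolding k_def weighted_inner_def
        by (simp add: algebra_simps sum.distrib sum_distrib_left power2_eq_square)
      ultimately show "0 \<le> 2 * t * (\<mu> * inner f g - energy H f g)
          + t\<^sup>2 * (\<mu> * inner g g - energy H g g)"
        using le[of k] ff by (simp add: \<mu>_def algebra_simps)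
    qed
    then show ?thesis by simp
  qed
  with ff have "laplacian_eigenvalue V H \<mu>"
    unfolding laplacian_eigenvalue_iff by blast
  with le show ?thesis using that by blast
qed

lemma largest_eigenvalue_is_eigenvalue: "laplacian_eigenvalue V H (largest_eigenvalue V H)"
proof -
  have "{\<mu>. laplacian_eigenvalue V H \<mu>} \<noteq> {}"
    using exists_maximal_eigenvalue by blast
  then show ?thesis
    using Max_in[OF finite_eigenvalues] by (simp add: largest_eigenvalue_def)
qed

lemma energy_le_largest_eigenvalue: "energy H f f \<le> largest_eigenvalue V H * inner f f"
proof -
  obtain \<mu> where \<mu>: "laplacian_eigenvalue V H \<mu>" and le: "\<And>f. energy H f f \<le> \<mu> * inner f f"
    using exists_maximal_eigenvalue by blast
  have "\<mu> \<le> largest_eigenvalue V H"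
    unfolding largest_eigenvalue_def using \<mu> finite_eigenvalues by (intro Max_ge) auto
  then show ?thesis
    using le[of f] inner_self_nonneg[of f] by (meson mult_right_mono order_trans)
qed

subsection \<open>The upper bound and its equality case\<close>

abbreviation max_card :: nat where
  "max_card \<equiv> Max (hyperedge_card ` H)"

text \<open>Double counting of incident pairs; it allows norm and energy to be compared hyperedge by
  hyperedge.\<close>

lemma inner_self_eq_sum_edges: "inner f f = (\<Sum>h\<in>H. \<Sum>v\<in>members h. (f v)\<^sup>2)"
proof -
  have "inner f f = (\<Sum>v\<in>V. \<Sum>h | h \<in> H \<and> v \<in> members h. (f v)\<^sup>2)"
    by (simp add: weighted_inner_def vertex_degree_def power2_eq_square)
  also have "\<dots> = (\<Sum>h\<in>H. \<Sum>v | v \<in> V \<and> v \<in> members h. (f v)\<^sup>2)"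
    by (rule sum.swap_restrict) auto
  also have "\<dots> = (\<Sum>h\<in>H. \<Sum>v\<in>members h. (f v)\<^sup>2)"
    using hyperedge(3) by (intro sum.cong) auto
  finally show ?thesis .
qed

lemma sum_incidence_times_squared:
  assumes "h \<in> H"
  shows "(\<Sum>v\<in>members h. (incidence h v * f v)\<^sup>2) = (\<Sum>v\<in>members h. (f v)\<^sup>2)"
  by (intro sum.cong) (simp_all add: power_mult_distrib incidence_square[OF assms])

text \<open>Cauchy-Schwarz against the constant 1; the incidence signs disappear on
  squaring.\<close>

lemma signed_sum_squared_le:
  assumes "h \<in> H"
  shows "(signed_sum f h)\<^sup>2 \<le> real (hyperedge_card h) * (\<Sum>v\<in>members h. (f v)\<^sup>2)"
  using sum_squared_le_sum_of_squares[of "\<lambda>v. incidence h v * f v" "members h"]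
  unfolding signed_sum_eq_members[OF assms] sum_incidence_times_squared[OF assms]
    card_members[OF assms] by (simp add: mult.commute)

lemma hyperedge_card_le: "h \<in> H \<Longrightarrow> hyperedge_card h \<le> max_card"
  by simp

lemma signed_sum_squared_le_max:
  assumes "h \<in> H"
  shows "(signed_sum f h)\<^sup>2 \<le> real max_card * (\<Sum>v\<in>members h. (f v)\<^sup>2)"
  using signed_sum_squared_le[OF assms, of f] hyperedge_card_le[OF assms]
  by (meson mult_right_mono of_nat_le_iff order_trans sum_nonneg zero_le_power2)

lemma energy_le_max_card: "energy H f f \<le> real max_card * inner f f"
  unfolding energy_def inner_self_eq_sum_edges sum_distrib_left[of _ _ H]
  using signed_sum_squared_le_max by (intro sum_mono) (simp flip: power2_eq_square)

lemma largest_eigenvalue_le: "largest_eigenvalue V H \<le> real max_card"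
proof -
  obtain f where "inner f f = 1" and "energy H f f = largest_eigenvalue V H * inner f f"
    using largest_eigenvalue_is_eigenvalue laplacian_eigenvalue_iff by blast
  then show ?thesis using energy_le_max_card[of f] by simp
qed

text \<open>Equality of the totals forces equality in every term, hence in both links of the chain
  through \<open>hyperedge_card h\<close>. The first link is the equality case of Cauchy-Schwarz;
  the second gives the cardinality when \<open>f\<close> does not vanish on
  \<open>h\<close>.\<close>

lemma tight_energy_imp_edge:
  assumes tight: "energy H f f = real max_card * inner f f" and h: "h \<in> H"
  shows "v \<in> members h \<Longrightarrow> w \<in> members h \<Longrightarrow> incidence h v * f v = incidence h w * f w"
    and "(\<Sum>v\<in>members h. (f v)\<^sup>2) > 0 \<Longrightarrow> hyperedge_card h = max_card"
proof -
  define q where "q = (\<lambda>h. \<Sum>v\<in>members h. (f v)\<^sup>2)"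
  have "(\<Sum>h\<in>H. real max_card * q h - (signed_sum f h)\<^sup>2) = 0"
    using tight
    by (simp add: energy_def inner_self_eq_sum_edges q_def power2_eq_square sum_subtractf
        sum_distrib_left)
  moreover have "\<And>h. h \<in> H \<Longrightarrow> real max_card * q h - (signed_sum f h)\<^sup>2 \<ge> 0"
    using signed_sum_squared_le_max by (simp add: q_def)
  ultimately have eq: "(signed_sum f h)\<^sup>2 = real max_card * q h"
    using sum_nonneg_eq_0_iff[OF finite_H, of "\<lambda>h. real max_card * q h - (signed_sum f h)\<^sup>2"] h
    by auto
  have "q h \<ge> 0" by (simp add: q_def sum_nonneg)
  then have "real (hyperedge_card h) * q h \<le> real max_card * q h"
    using hyperedge_card_le[OF h] by (intro mult_right_mono) auto
  moreover have "(signed_sum f h)\<^sup>2 \<le> real (hyperedge_card h) * q h"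
    using signed_sum_squared_le[OF h] by (simp add: q_def)
  ultimately have eq_card: "(signed_sum f h)\<^sup>2 = real (hyperedge_card h) * q h"
    using eq by linarith
  then show "hyperedge_card h = max_card" if "(\<Sum>v\<in>members h. (f v)\<^sup>2) > 0"
  proof -
    have "real max_card * q h = real (hyperedge_card h) * q h"
      using eq eq_card by metis
    moreover have "q h \<noteq> 0" using that by (simp add: q_def)
    ultimately show ?thesis by (simp only: mult_cancel_right of_nat_eq_iff) simp
  qed
  show "incidence h v * f v = incidence h w * f w" if "v \<in> members h" "w \<in> members h"
    using sum_squared_eq_card_times_sum_of_squares
      [of "members h" "\<lambda>v. incidence h v * f v" v w] eq_card that hyperedge(6)[OF h]
    by (simp add: signed_sum_eq_members h sum_incidence_times_squared card_members q_def)
qed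

text \<open>Consecutive vertices of a connecting path share a hyperedge, so induction along the path
  carries the value of \<open>g\<close> from \<open>v\<close> to \<open>w\<close>.\<close>

lemma connected_propagate:
  assumes "connected_hypergraph V H" and "v \<in> V" and "w \<in> V"
    and step: "\<And>h a b. h \<in> H \<Longrightarrow> a \<in> members h \<Longrightarrow> b \<in> members h \<Longrightarrow> g a = g b"
  shows "g v = g w"
proof -
  obtain vs hs where len: "length vs = Suc (length hs)" and ends: "hd vs = v" "last vs = w"
    and H: "set hs \<subseteq> H"
    and adj: "\<And>i. i < length hs \<Longrightarrow> vs ! i \<in> members (hs ! i) \<and> vs ! Suc i \<in> members (hs ! i)"
    using assms(1-3) unfolding connected_hypergraph_def by metis
  have "vs \<noteq> []" using len by auto
  have "i \<le> length hs \<Longrightarrow> g (vs ! i) = g (vs ! 0)" for i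
  proof (induction i)
    case (Suc i)
    then have "hs ! i \<in> H" using H by auto
    with Suc adj[of i] step show ?case by (metis Suc_leD Suc_le_eq)
  qed simp
  from this[of "length hs"] show ?thesis
    using ends \<open>vs \<noteq> []\<close> len by (simp add: hd_conv_nth last_conv_nth)
qed

lemma bipartite_regular_of_largest_eigenvalue:
  assumes "connected_hypergraph V H" and eq: "largest_eigenvalue V H = real max_card"
  shows "bipartite_hypergraph V H" and "h \<in> H \<Longrightarrow> hyperedge_card h = max_card"
proof -
  obtain f where ff: "inner f f = 1" and "energy H f f = largest_eigenvalue V H * inner f f"
    using largest_eigenvalue_is_eigenvalue laplacian_eigenvalue_iff by blast
  then have tight: "energy H f f = real max_card * inner f f" by (simp add: eq)
  note edge = tight_energy_imp_edge[OF tight]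
  \<comment> \<open>The sign of \<open>f\<close> changes between inputs and outputs, so
    connectedness is applied to the absolute value.\<close>
  have abs_edge: "\<bar>f a\<bar> = \<bar>f b\<bar>" if "h \<in> H" "a \<in> members h" "b \<in> members h" for h a b
  proof -
    have "(incidence h a * f a)\<^sup>2 = (incidence h b * f b)\<^sup>2"
      using edge(1)[OF that] by simp
    then show ?thesis
      by (simp add: power_mult_distrib incidence_square that power2_eq_iff abs_eq_iff)
  qed
  obtain u where u: "u \<in> V" "f u \<noteq> 0"
    using ff by (force simp: weighted_inner_def intro: ccontr)
  have nonzero: "f w \<noteq> 0" if "w \<in> V" for w
  proof -
    have "\<bar>f u\<bar> = \<bar>f w\<bar>"
      by (rule connected_propagate[OF assms(1) u(1) that]) (rule abs_edge)
    with u(2) show ?thesis by auto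
  qed
  show "hyperedge_card h = max_card" if h: "h \<in> H" for h
  proof -
    obtain a where a: "a \<in> members h" using hyperedge(1)[OF h] by (auto simp: members_def)
    then have "(\<Sum>v\<in>members h. (f v)\<^sup>2) > 0"
      using nonzero[of a] hyperedge[OF h] by (intro sum_pos2[of _ a]) auto
    then show ?thesis using edge(2)[OF h] by simp
  qed
  show "bipartite_hypergraph V H"
    unfolding bipartite_hypergraph_def
  proof (intro exI conjI ballI)
    show "{v \<in> V. f v > 0} \<union> {v \<in> V. f v < 0} = V"
      using nonzero by (auto simp: linorder_neq_iff)
    fix h assume h: "h \<in> H"
    obtain a where a: "a \<in> inputs h" using hyperedge(1)[OF h] by auto
    \<comment> \<open>Constancy of \<open>incidence h v * f v\<close> on \<open>h\<close> gives
      \<open>f\<close> the value \<open>f a\<close> on inputs and \<open>- f a\<close> on outputs;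
      the sign of \<open>f a\<close> selects the orientation.\<close>
    have "f v = f a" if "v \<in> inputs h" for v
      using edge(1)[OF h, of v a] that a
      by (simp add: members_def h incidence_inputs incidence_outputs)
    moreover have "f v = - f a" if "v \<in> outputs h" for v
      using edge(1)[OF h, of v a] that a
      by (simp add: members_def h incidence_inputs incidence_outputs)
    moreover have "f a \<noteq> 0" and "inputs h \<subseteq> V" and "outputs h \<subseteq> V"
      using nonzero a hyperedge(3)[OF h] by (auto simp: members_def)
    ultimately show "inputs h \<subseteq> {v \<in> V. f v > 0} \<and> outputs h \<subseteq> {v \<in> V. f v < 0}
        \<or> inputs h \<subseteq> {v \<in> V. f v < 0} \<and> outputs h \<subseteq> {v \<in> V. f v > 0}"
      by (cases "f a > 0") auto
  qed auto
qed

text \<open>The test function is 1 on one class and -1 on the other. No signed sum cancels, so each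
  has absolute value \<open>m\<close>, and the Rayleigh quotient is \<open>m\<close>.\<close>

lemma regularity_le_largest_eigenvalue:
  assumes "bipartite_hypergraph V H" and reg: "\<And>h. h \<in> H \<Longrightarrow> hyperedge_card h = m"
  shows "real m \<le> largest_eigenvalue V H"
proof -
  obtain V1 V2 where V12: "V1 \<union> V2 = V" "V1 \<inter> V2 = {}"
    and bip: "\<And>h. h \<in> H \<Longrightarrow> inputs h \<subseteq> V1 \<and> outputs h \<subseteq> V2 \<or> inputs h \<subseteq> V2 \<and> outputs h \<subseteq> V1"
    using assms(1) unfolding bipartite_hypergraph_def by metis
  define f :: "'v \<Rightarrow> real" where "f = (\<lambda>v. if v \<in> V1 then 1 else -1)"
  have [simp]: "(f v)\<^sup>2 = 1" for v by (simp add: f_def)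
  have "(signed_sum f h)\<^sup>2 = (real m)\<^sup>2" if h: "h \<in> H" for h
  proof -
    have "signed_sum f h = s * (card (inputs h) + card (outputs h))"
      if s: "\<And>v. v \<in> inputs h \<Longrightarrow> f v = s" "\<And>v. v \<in> outputs h \<Longrightarrow> f v = - s" for s
      by (simp add: signed_sum_def s algebra_simps)
    moreover have "(\<forall>v\<in>inputs h. f v = 1) \<and> (\<forall>v\<in>outputs h. f v = -1)
        \<or> (\<forall>v\<in>inputs h. f v = -1) \<and> (\<forall>v\<in>outputs h. f v = 1)"
      using bip[OF h] V12(2) by (auto simp: f_def)
    ultimately have "\<bar>signed_sum f h\<bar> = real (hyperedge_card h)"
      unfolding hyperedge_card_def by fastforce
    then show ?thesis using reg[OF h] by (metis power2_abs)
  qed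
  then have "energy H f f = (\<Sum>h\<in>H. (real m)\<^sup>2)"
    by (simp add: energy_def flip: power2_eq_square)
  also have "\<dots> = real m * inner f f"
  proof -
    have "inner f f = (\<Sum>h\<in>H. real m)"
      by (simp add: inner_self_eq_sum_edges card_members reg)
    then show ?thesis by (simp add: power2_eq_square)
  qed
  finally have "real m * inner f f \<le> largest_eigenvalue V H * inner f f"
    using energy_le_largest_eigenvalue[of f] by simp
  moreover obtain v where "v \<in> V" using vertices_nonempty by blast
  ultimately show ?thesis
    using inner_self_pos[of v f] by (simp add: f_def)
qed

subsection \<open>The lower bound\<close>

text \<open>An operator and its adjoint have the same norm: the map from \<open>\<gamma>\<close> to
  \<open>f\<close> is adjoint to \<open>signed_sum\<close>. Concretely, the left side
  \<open>A\<close> is the squared norm of \<open>f\<close>, and Cauchy-Schwarz with the Rayleigh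
  bound gives an inequality from which one factor \<open>A\<close> cancels.\<close>

lemma sum_incidence_squared_le:
  "(\<Sum>v\<in>V. (\<Sum>h\<in>H. incidence h v * \<gamma> h)\<^sup>2 / real (vertex_degree H v))
    \<le> largest_eigenvalue V H * (\<Sum>h\<in>H. (\<gamma> h)\<^sup>2)"
proof -
  define f where "f = (\<lambda>v. (\<Sum>h\<in>H. incidence h v * \<gamma> h) / real (vertex_degree H v))"
  define A where "A = (\<Sum>v\<in>V. (\<Sum>h\<in>H. incidence h v * \<gamma> h)\<^sup>2 / real (vertex_degree H v))"
  define \<Lambda> where "\<Lambda> = largest_eigenvalue V H"
  have ff: "inner f f = A"
    unfolding weighted_inner_def A_def
    by (intro sum.cong) (use degree_pos in \<open>auto simp: f_def power2_eq_square\<close>)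
  have "A = (\<Sum>v\<in>V. (\<Sum>h\<in>H. incidence h v * \<gamma> h) * f v)"
    by (simp add: A_def f_def power2_eq_square)
  then have A: "A = (\<Sum>h\<in>H. \<gamma> h * signed_sum f h)"
    by (simp add: sum_incidence_swap)
  have "A\<^sup>2 \<le> (\<Sum>h\<in>H. (\<gamma> h)\<^sup>2) * energy H f f"
    unfolding A energy_def power2_eq_square[of "signed_sum f _", symmetric]
    by (rule Cauchy_Schwarz_ineq_sum)
  also have "\<dots> \<le> (\<Sum>h\<in>H. (\<gamma> h)\<^sup>2) * (\<Lambda> * A)"
    using energy_le_largest_eigenvalue[of f]
    by (intro mult_left_mono) (auto simp: ff \<Lambda>_def sum_nonneg)
  finally have le: "A * A \<le> A * (\<Lambda> * (\<Sum>h\<in>H. (\<gamma> h)\<^sup>2))"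
    by (simp add: power2_eq_square mult_ac)
  \<comment> \<open>Settles the case \<open>A = 0\<close>, where nothing can be cancelled.\<close>
  have "\<Lambda> \<ge> 0"
  proof -
    obtain f where "inner f f = 1" and "energy H f f = \<Lambda> * inner f f"
      using largest_eigenvalue_is_eigenvalue laplacian_eigenvalue_iff unfolding \<Lambda>_def by blast
    moreover have "energy H f f \<ge> 0" by (simp add: energy_def sum_nonneg)
    ultimately show ?thesis by simp
  qed
  then have "0 \<le> \<Lambda> * (\<Sum>h\<in>H. (\<gamma> h)\<^sup>2)" by (simp add: sum_nonneg)
  moreover have "A \<ge> 0" using inner_self_nonneg[of f] ff by simp
  ultimately show ?thesis
    using le by (cases "A = 0") (simp_all add: A_def \<Lambda>_def mult_le_cancel_left)
qed

lemma eta_ratio_le_largest_eigenvalue: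
  assumes "P \<in> bipartite_sub_hypergraphs V H"
  shows "eta_ratio H P \<le> largest_eigenvalue V H"
proof -
  obtain U H' where P: "P = (U, H')" and U: "U \<subseteq> V" and H': "H' \<subseteq> H" "H' \<noteq> {}"
    and U_bipartite: "bipartite_hypergraph U (restrict_hyperedge U ` H')"
    using assms by (auto simp: bipartite_sub_hypergraphs_def sub_hypergraphs_def)
  obtain V1 V2 where V12: "V1 \<union> V2 = U" "V1 \<inter> V2 = {}"
    and bip: "\<And>h. h \<in> H' \<Longrightarrow> inputs h \<inter> U \<subseteq> V1 \<and> outputs h \<inter> U \<subseteq> V2
        \<or> inputs h \<inter> U \<subseteq> V2 \<and> outputs h \<inter> U \<subseteq> V1"
    using U_bipartite unfolding bipartite_hypergraph_def restrict_hyperedge_def ball_simps fst_conv snd_conv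
    by metis
  \<comment> \<open>The sign records the orientation relative to the bipartition. A hyperedge of
    \<open>H'\<close> admits both orientations only if it misses \<open>U\<close>; it gets 1 and
    still counts in \<open>card H'\<close>.\<close>
  define \<gamma> :: "'v hyperedge \<Rightarrow> real" where
    "\<gamma> = (\<lambda>h. if h \<notin> H' then 0 else if inputs h \<inter> U \<subseteq> V1 \<and> outputs h \<inter> U \<subseteq> V2 then 1 else -1)"
  define s :: "'v \<Rightarrow> real" where "s = (\<lambda>v. if v \<in> V1 then 1 else -1)"
  have finite_H': "finite H'" using H'(1) finite_H finite_subset by blast
  \<comment> \<open>Reversing a hyperedge flips both factors on the left, so all contributions at
    \<open>v\<close> share the sign \<open>s v\<close> and add up to the degree in
    \<open>H'\<close>.\<close>
  have no_cancel: "incidence h v * \<gamma> h = of_bool (h \<in> H' \<and> v \<in> members h) * s v"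
    if "h \<in> H" "v \<in> U" for h v
  proof (cases "h \<in> H' \<and> v \<in> members h")
    case True
    then show ?thesis
      using bip[of h] V12 hyperedge(2)[OF that(1)] that(2)
      by (auto simp: \<gamma>_def s_def incidence_def members_def)
  next
    case False
    then show ?thesis by (auto simp: \<gamma>_def incidence_def members_def)
  qed
  have deg: "(\<Sum>h\<in>H. incidence h v * \<gamma> h)\<^sup>2 = (real (vertex_degree H' v))\<^sup>2" if v: "v \<in> U" for v
  proof -
    have "(\<Sum>h\<in>H. incidence h v * \<gamma> h) = (\<Sum>h\<in>H. of_bool (h \<in> H' \<and> v \<in> members h)) * s v"
      unfolding sum_distrib_right using no_cancel[OF _ v] by (intro sum.cong) auto
    also have "(\<Sum>h\<in>H. of_bool (h \<in> H' \<and> v \<in> members h)) = real (vertex_degree H' v)"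
      using H'(1) by (simp add: vertex_degree_def of_bool_def sum.If_cases Int_def)
        (meson subset_iff)
    finally show ?thesis by (simp add: s_def power_mult_distrib)
  qed
  have "(\<Sum>h\<in>H. (\<gamma> h)\<^sup>2) = (\<Sum>h\<in>H'. (\<gamma> h)\<^sup>2)"
    using H'(1) by (intro sum.mono_neutral_right) (auto simp: \<gamma>_def)
  also have "\<dots> = (\<Sum>h\<in>H'. 1)"
    by (intro sum.cong) (auto simp: \<gamma>_def)
  finally have \<gamma>: "(\<Sum>h\<in>H. (\<gamma> h)\<^sup>2) = real (card H')" by simp
  have "(\<Sum>v\<in>U. (real (vertex_degree H' v))\<^sup>2 / real (vertex_degree H v))
      = (\<Sum>v\<in>U. (\<Sum>h\<in>H. incidence h v * \<gamma> h)\<^sup>2 / real (vertex_degree H v))"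
    by (intro sum.cong) (simp_all add: deg)
  also have "\<dots> \<le> (\<Sum>v\<in>V. (\<Sum>h\<in>H. incidence h v * \<gamma> h)\<^sup>2 / real (vertex_degree H v))"
    using U by (intro sum_mono2) auto
  also have "\<dots> \<le> largest_eigenvalue V H * real (card H')"
    using sum_incidence_squared_le[of \<gamma>] by (simp add: \<gamma>)
  finally show ?thesis
    using H'(2) finite_H' by (simp add: P eta_ratio_def divide_le_eq card_gt_0_iff)
qed

lemma Max_eta_ratio_le:
  "Max (eta_ratio H ` bipartite_sub_hypergraphs V H) \<le> largest_eigenvalue V H"
proof -
  have "bipartite_sub_hypergraphs V H \<subseteq> Pow V \<times> Pow H"
    by (auto simp: bipartite_sub_hypergraphs_def sub_hypergraphs_def)
  then have "finite (bipartite_sub_hypergraphs V H)"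
    by (rule finite_subset) simp
  \<comment> \<open>Over the empty vertex set bipartiteness is trivial, so the \<open>Max\<close>
    ranges over a nonempty set.\<close>
  moreover have "({}, H) \<in> bipartite_sub_hypergraphs V H"
    using edges_nonempty
    by (auto simp: bipartite_sub_hypergraphs_def sub_hypergraphs_def bipartite_hypergraph_def
        restrict_hyperedge_def)
  ultimately show ?thesis
    using eta_ratio_le_largest_eigenvalue by (subst Max_le_iff) auto
qed

end

theorem theorem1:
  fixes V :: "'v set" and H :: "'v hyperedge set"
  assumes "oriented_hypergraph V H"
    and "V \<noteq> {}"
    and "connected_hypergraph V H"
    and "\<forall>v\<in>V. vertex_degree H v > 0"
  shows "largest_eigenvalue V H \<le> real (Max (hyperedge_card ` H))
    \<and> (largest_eigenvalue V H = real (Max (hyperedge_card ` H))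
         \<longleftrightarrow> bipartite_hypergraph V H \<and> (\<forall>h\<in>H. \<forall>h'\<in>H. hyperedge_card h = hyperedge_card h'))
    \<and> largest_eigenvalue V H \<ge> Max (eta_ratio H ` bipartite_sub_hypergraphs V H)"
proof -
  interpret positive_degree_hypergraph V H
    using assms by unfold_locales auto
  have "largest_eigenvalue V H = real max_card"
    if "bipartite_hypergraph V H" and reg: "\<forall>h\<in>H. \<forall>h'\<in>H. hyperedge_card h = hyperedge_card h'"
  proof -
    have "max_card \<in> hyperedge_card ` H"
      using edges_nonempty by (intro Max_in) auto
    then obtain h' where h': "h' \<in> H" "max_card = hyperedge_card h'"
      by blast
    have "hyperedge_card h = max_card" if "h \<in> H" for h
      unfolding h'(2) using reg that h'(1) by blast
    from regularity_le_largest_eigenvalue[OF that(1) this] show ?thesis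
      by (intro antisym largest_eigenvalue_le)
  qed
  moreover have "bipartite_hypergraph V H \<and> (\<forall>h\<in>H. \<forall>h'\<in>H. hyperedge_card h = hyperedge_card h')"
    if "largest_eigenvalue V H = real max_card"
    using bipartite_regular_of_largest_eigenvalue[OF assms(3) that] by simp
  ultimately show ?thesis
    using largest_eigenvalue_le Max_eta_ratio_le by blast
qed

end
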